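(* Let $\mathcal D$ be a smooth compact convex subset of $\mathbb R^2$ and $O$ an interior point of it. For the lines $l(\varphi)$ through $O$ put $[\tilde A(\varphi)\tilde B(\varphi)]=l(\varphi)\cap\mathcal D$ and $\tilde f(\varphi)=|\tilde A(\varphi)\tilde B(\varphi)|$, and let $t_1(\varphi)$, $t_2(\varphi)$ be the tangents to $\partial\mathcal D$ at $\tilde A(\varphi)$ and $\tilde B(\varphi)$. Then for every local maximizer and every local minimizer $\varphi_0$ of $\tilde f$, CPP holds for the lines $t_1(\varphi_0)$, $t_2(\varphi_0)$, $l(\varphi_0)$ and the points $\tilde A(\varphi_0)$, $\tilde B(\varphi_0)$, $O$.
   Context: $l(\varphi)$ denotes the line through $O$ obtained by rotating a fixed line through $O$ by the angle $\varphi$ (in radians) around $O$. $|AB|$ is the length of the segment $[AB]$. A line $p$ is tangent to a curve $\gamma\subset\mathbb R^2$ at a point $P_0\in p\cap\gamma$ if there is an open disc $U$ centered at $P_0$ such that, in a rectangular coordinate system with $p$ as abscissa axis, $\gamma\cap U$ is the graph of a continuous real-valued function which is differentiable at $P_0$ with derivative zero there. A convex set $\mathcal D\subset\mathbb R^2$ is smooth if its boundary $\partial\mathcal D$ has a tangent at every point (equivalently, for convex sets with nonempty interior: there is exactly one supporting line at every boundary point, and that line is the tangent). CPP (Concurrent Perpendiculars Property) for lines $l_1\ni A$, $l_2\ni B$, a line $l$ passing through $A,B,O$, and the points $A,B,O$: the perpendicular to $l_1$ at $A$, the perpendicular to $l_2$ at $B$ and the perpendicular to $l$ at $O$ have a common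 point. *)

theory Defs
  imports "HOL-Analysis.Analysis"
begin

definition rotate_plane :: "real \<Rightarrow> real^2 \<Rightarrow> real^2" where
  "rotate_plane \<phi> x =
     vector [cos \<phi> * x $ 1 - sin \<phi> * x $ 2, sin \<phi> * x $ 1 + cos \<phi> * x $ 2]"

definition is_line :: "(real^2) set \<Rightarrow> bool" where
  "is_line l \<longleftrightarrow> affine l \<and> aff_dim l = 1"

definition rotated_line :: "(real^2) set \<Rightarrow> real^2 \<Rightarrow> real \<Rightarrow> (real^2) set" where
  "rotated_line l c \<phi> = (\<lambda>x. c + rotate_plane \<phi> (x - c)) ` l"

text \<open>
  The rectangular coordinate system has origin \<open>Q\<close> and orthonormal axis directions
  \<open>u\<close>, \<open>v\<close>; the abscissa axis is \<open>p\<close>. The function \<open>g\<close> is defined on the open set \<open>S\<close>,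
  which contains the abscissa \<open>(P - Q) \<bullet> u\<close> of \<open>P\<close> because \<open>P \<in> \<gamma> \<inter> ball P r\<close>, so that
  the derivative of \<open>g\<close> there does not depend on values outside \<open>S\<close>.
\<close>

definition tangent_line :: "(real^2) set \<Rightarrow> (real^2) set \<Rightarrow> real^2 \<Rightarrow> bool" where
  "tangent_line p \<gamma> P \<longleftrightarrow>
     P \<in> p \<inter> \<gamma> \<and>
     (\<exists>r>0. \<exists>Q u v S (g :: real \<Rightarrow> real).
        norm u = 1 \<and> norm v = 1 \<and> u \<bullet> v = 0 \<and>
        p = range (\<lambda>s. Q + s *\<^sub>R u) \<and>
        open S \<and> continuous_on S g \<and>
        \<gamma> \<inter> ball P r = (\<lambda>s. Q + s *\<^sub>R u + g s *\<^sub>R v) ` S \<and>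
        (g has_real_derivative 0) (at ((P - Q) \<bullet> u)))"

definition smooth_convex :: "(real^2) set \<Rightarrow> bool" where
  "smooth_convex D \<longleftrightarrow> convex D \<and> (\<forall>P\<in>frontier D. \<exists>p. tangent_line p (frontier D) P)"

definition perpendicular_at :: "(real^2) set \<Rightarrow> real^2 \<Rightarrow> (real^2) set" where
  "perpendicular_at l P = {x. \<forall>y\<in>l. \<forall>z\<in>l. (x - P) \<bullet> (y - z) = 0}"

text \<open>
  Used only for lines \<open>l1\<close> through \<open>A\<close>, \<open>l2\<close> through \<open>B\<close> and \<open>l\<close> through \<open>A\<close>, \<open>B\<close>, \<open>c\<close>;
  these incidences are preconditions and not part of the property.
\<close>

definition CPP ::
  "(real^2) set \<Rightarrow> (real^2) set \<Rightarrow> (real^2) set \<Rightarrow> real^2 \<Rightarrow> real^2 \<Rightarrow> real^2 \<Rightarrow> bool" where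
  "CPP l1 l2 l A B c \<longleftrightarrow>
     perpendicular_at l1 A \<inter> perpendicular_at l2 B \<inter> perpendicular_at l c \<noteq> {}"

definition local_maximizer :: "(real \<Rightarrow> real) \<Rightarrow> real \<Rightarrow> bool" where
  "local_maximizer f x \<longleftrightarrow> (\<forall>\<^sub>F y in nhds x. f y \<le> f x)"

definition local_minimizer :: "(real \<Rightarrow> real) \<Rightarrow> real \<Rightarrow> bool" where
  "local_minimizer f x \<longleftrightarrow> (\<forall>\<^sub>F y in nhds x. f x \<le> f y)"

end

theory Submission imports Defs begin

text \<open>
  Let \<open>E \<phi>\<close> be the unit direction of \<open>l(\<phi>)\<close>, \<open>E'\<close> its derivative, and \<open>p\<close>, \<open>q\<close> the distances from
  \<open>O\<close> to the boundary in the directions \<open>E\<close> and \<open>-E\<close>, so that \<open>f = p + q\<close>. The tangent at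
  \<open>A = O + p E\<close> has direction \<open>p' E + p E'\<close>, hence the perpendicular to it at \<open>A\<close> meets
  the perpendicular to \<open>l\<close> at \<open>O\<close> in \<open>O + p' E'\<close>; the one at \<open>B\<close> meets it in \<open>O - q' E'\<close>.
  The two points coincide iff \<open>f' = p' + q' = 0\<close>.

  That \<open>p\<close> is differentiable: \<open>p\<close> is continuous, and in coordinates along the tangent the
  boundary point is \<open>(s, h s * s)\<close> with \<open>h s \<longlongrightarrow> 0\<close>, a linear equation for \<open>p \<phi> - p \<phi>0\<close> which
  is solvable because the tangent misses the interior point \<open>O\<close>.
\<close>

section \<open>The radial function of a convex body about an interior point\<close>

definition radial :: "'a::euclidean_space set \<Rightarrow> 'a \<Rightarrow> 'a \<Rightarrow> real" where
  "radial D c x = (THE k. 0 < k \<and> c + k *\<^sub>R x \<in> frontier D)"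

context
  fixes D :: "'a::euclidean_space set" and c :: 'a
  assumes D: "convex D" "compact D" and c: "c \<in> interior D"
begin

text \<open>A ray from \<open>c\<close> leaves \<open>D\<close> only once: if \<open>D\<close> had a
  point beyond the first boundary point, shrinking it towards the interior point \<open>c\<close>
  would make that boundary point interior.\<close>

lemma ray_frontier:
  assumes "x \<noteq> 0"
  shows "\<exists>k>0. \<forall>t. (0 < t \<and> c + t *\<^sub>R x \<in> frontier D \<longleftrightarrow> t = k) \<and>
           (0 \<le> t \<longrightarrow> (c + t *\<^sub>R x \<in> D \<longleftrightarrow> t \<le> k))"
proof -
  obtain k where k: "0 < k" "c + k *\<^sub>R x \<in> frontier D"
    and int: "\<And>e. 0 \<le> e \<Longrightarrow> e < k \<Longrightarrow> c + e *\<^sub>R x \<in> interior D"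
    using ray_to_frontier[OF compact_imp_bounded[OF D(2)] c assms] by metis
  have cl: "closure D = D"
    using D(2) by (simp add: compact_imp_closed)
  have beyond: "c + t *\<^sub>R x \<notin> D" if "k < t" for t
  proof
    assume "c + t *\<^sub>R x \<in> D"
    \<comment> \<open>The factor \<open>1 - k / t\<close> is chosen so that shrinking towards
      \<open>c\<close> lands exactly on the exit point.\<close>
    then have "(c + t *\<^sub>R x) - (1 - k / t) *\<^sub>R ((c + t *\<^sub>R x) - c) \<in> interior D"
      using that k(1) cl by (intro mem_interior_closure_convex_shrink[OF D(1) c]) auto
    moreover have "(c + t *\<^sub>R x) - (1 - k / t) *\<^sub>R ((c + t *\<^sub>R x) - c) = c + k *\<^sub>R x"
      using that k(1) by (simp add: algebra_simps)
    ultimately show False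
      using k(2) unfolding frontier_def by (metis DiffD2)
  qed
  have fr: "c + t *\<^sub>R x \<in> frontier D \<longleftrightarrow> t = k" if "0 \<le> t" for t
    using int[OF that] beyond[of t] k(2) cl by (cases t k rule: linorder_cases) (auto simp: frontier_def)
  have inD: "c + t *\<^sub>R x \<in> D \<longleftrightarrow> t \<le> k" if "0 \<le> t" for t
    using int[OF that] beyond[of t] k(2) cl interior_subset[of D]
    by (cases t k rule: linorder_cases) (auto simp: frontier_def)
  show ?thesis
    using k(1) fr inD by (intro exI[of _ k]) (auto simp: less_imp_le)
qed

text \<open>Uniqueness in \<open>ray_frontier\<close> makes the definite description meaningful;
  \<open>radial D c x\<close> is then the reciprocal of the Minkowski gauge of \<open>D\<close>
  translated by \<open>- c\<close>.\<close>

lemma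
  assumes "x \<noteq> 0"
  shows radial_eq_iff: "0 < k \<and> c + k *\<^sub>R x \<in> frontier D \<longleftrightarrow> radial D c x = k"
    and mem_iff_le_radial: "0 \<le> k \<Longrightarrow> c + k *\<^sub>R x \<in> D \<longleftrightarrow> k \<le> radial D c x"
proof -
  obtain r where "0 < r"
    and r: "\<And>t. 0 < t \<and> c + t *\<^sub>R x \<in> frontier D \<longleftrightarrow> t = r"
      "\<And>t. 0 \<le> t \<Longrightarrow> c + t *\<^sub>R x \<in> D \<longleftrightarrow> t \<le> r"
    using ray_frontier[OF assms] by blast
  have "radial D c x = r"
    unfolding radial_def r(1) by simp
  then show "0 < k \<and> c + k *\<^sub>R x \<in> frontier D \<longleftrightarrow> radial D c x = k"
    and "0 \<le> k \<Longrightarrow> c + k *\<^sub>R x \<in> D \<longleftrightarrow> k \<le> radial D c x"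
    using r by auto
qed

lemma radial_pos: "x \<noteq> 0 \<Longrightarrow> 0 < radial D c x"
  and radial_frontier: "x \<noteq> 0 \<Longrightarrow> c + radial D c x *\<^sub>R x \<in> frontier D"
  using radial_eq_iff by blast+

text \<open>The compact boundary, moved so that \<open>c\<close> becomes the origin, is met once by
  each ray, so projection onto it along rays is continuous; comparing norms recovers the
  factor.\<close>

lemma continuous_on_radial: "continuous_on (- {0}) (radial D c)"
proof -
  have "continuous_on (UNIV - {0}) (\<lambda>x. radial D c x *\<^sub>R x)"
  proof (rule continuous_on_compact_surface_projection)
    show "compact ((\<lambda>y. y - c) ` frontier D)"
      using D(2) by (intro compact_continuous_image continuous_intros compact_frontier)
    show "(\<lambda>y. y - c) ` frontier D \<subseteq> UNIV - {0}"
      using c by (auto simp: frontier_def)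
    show "cone (UNIV :: 'a set)"
      by (rule cone_univ)
    show "0 < k \<and> k *\<^sub>R x \<in> (\<lambda>y. y - c) ` frontier D \<longleftrightarrow> radial D c x = k"
      if "x \<in> UNIV - {0}" for x k
    proof -
      have "k *\<^sub>R x \<in> (\<lambda>y. y - c) ` frontier D \<longleftrightarrow> c + k *\<^sub>R x \<in> frontier D"
        by (auto simp: image_iff algebra_simps)
      then show ?thesis
        using radial_eq_iff[of x k] that by auto
    qed
  qed
  then have "continuous_on (- {0}) (\<lambda>x. norm (radial D c x *\<^sub>R x) / norm x)"
    unfolding Compl_eq_Diff_UNIV
    by (intro continuous_on_divide continuous_on_norm continuous_on_id) auto
  moreover have "norm (radial D c x *\<^sub>R x) / norm x = radial D c x" if "x \<in> - {0}" for x
    using that radial_pos[of x] by simp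
  ultimately show ?thesis
    by (rule continuous_on_eq)
qed

text \<open>Identifies the ends of the chord with radial points; a negative parameter
  \<open>t\<close> is treated as \<open>- t\<close> on the opposite ray.\<close>

lemma line_inter_eq_closed_segment:
  assumes "x \<noteq> 0"
  shows "range (\<lambda>t. c + t *\<^sub>R x) \<inter> D =
    closed_segment (c + radial D c x *\<^sub>R x) (c + radial D c (- x) *\<^sub>R (- x))"
proof -
  let ?p = "radial D c x" and ?q = "radial D c (- x)"
  have pq: "0 < ?p" "0 < ?q"
    using assms by (auto intro: radial_pos)
  have "c + t *\<^sub>R x \<in> D \<longleftrightarrow> t \<in> closed_segment ?p (- ?q)" for t
    using mem_iff_le_radial[of x t] mem_iff_le_radial[of "- x" "- t"] assms pq
    by (cases "0 \<le> t") (auto simp: closed_segment_eq_real_ivl)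
  then have "range (\<lambda>t. c + t *\<^sub>R x) \<inter> D = (\<lambda>t. c + t *\<^sub>R x) ` closed_segment ?p (- ?q)"
    by auto
  also have "\<dots> = (+) c ` (\<lambda>t. t *\<^sub>R x) ` closed_segment ?p (- ?q)"
    by (simp add: image_image)
  also have "\<dots> = closed_segment (c + ?p *\<^sub>R x) (c + (- ?q) *\<^sub>R x)"
    by (subst closed_segment_linear_image[symmetric])
      (simp_all add: linear_scaleR_left flip: closed_segment_translation)
  finally show ?thesis by simp
qed

end

section \<open>Tangent coordinates and differentiability of the radial function\<close>

lemma orthonormal_expansion_2:
  fixes u v x :: "real^2"
  assumes "norm u = 1" "norm v = 1" "u \<bullet> v = 0"
  shows "x = (x \<bullet> u) *\<^sub>R u + (x \<bullet> v) *\<^sub>R v"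
proof -
  have ne: "u \<noteq> v"
    using assms by (metis norm_eq_1 zero_neq_one)
  have "independent {u, v}"
    using assms by (intro pairwise_orthogonal_independent)
      (auto simp: pairwise_def orthogonal_def inner_commute)
  then have "span {u, v} = UNIV"
    using ne by (intro dim_eq_full[THEN iffD1]) (simp add: dim_eq_card_independent)
  then have "(\<Sum>i\<in>{u, v}. (x \<bullet> i) *\<^sub>R i) = x"
    using assms by (intro orthonormal_basis_expand)
      (auto simp: pairwise_def orthogonal_def inner_commute)
  then show ?thesis
    using ne by simp
qed

text \<open>
  The supporting functional at \<open>P\<close> restricted to the boundary curve is extremal at \<open>P\<close>, so it
  annihilates the tangent direction; it is positive on \<open>c - P\<close>.
\<close>

lemma tangent_graph_transversal:
  fixes D :: "(real^2) set"
  assumes "convex D" "compact D" "c \<in> interior D"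
    and uv: "norm u = 1" "norm v = 1" "u \<bullet> v = 0"
    and "open S" "r > 0" "P \<in> frontier D"
    and graph: "frontier D \<inter> ball P r = (\<lambda>s. Q + s *\<^sub>R u + g s *\<^sub>R v) ` S"
    and der: "(g has_real_derivative 0) (at ((P - Q) \<bullet> u))"
  shows "(P - c) \<bullet> v \<noteq> 0"
proof
  assume 0: "(P - c) \<bullet> v = 0"
  define s0 where "s0 = (P - Q) \<bullet> u"
  have sub: "frontier D \<subseteq> D"
    using assms(2) by (simp add: compact_imp_closed frontier_subset_closed)
  have ri: "rel_interior D = interior D"
    using assms(3) rel_interior_nonempty_interior by blast
  \<comment> \<open>The inequality is strict at \<open>c\<close> because \<open>c\<close> lies in
    the relative interior.\<close>
  obtain a where a: "\<And>y. y \<in> D \<Longrightarrow> a \<bullet> P \<le> a \<bullet> y"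
      and ac: "a \<bullet> P < a \<bullet> c"
    using supporting_hyperplane_rel_boundary[of D P] assms(1,3,9) sub ri
    unfolding frontier_def by (metis DiffD2 assms(9) subsetD)
  have uv1: "u \<bullet> u = 1" "v \<bullet> v = 1" "v \<bullet> u = 0"
    using uv by (auto simp: norm_eq_1 inner_commute)
  have "P \<in> (\<lambda>s. Q + s *\<^sub>R u + g s *\<^sub>R v) ` S"
    using graph assms(8,9) by auto
  then have s0: "s0 \<in> S" and P: "P = Q + s0 *\<^sub>R u + g s0 *\<^sub>R v"
    by (auto simp: s0_def inner_add_left uv1)
  obtain d where d: "d > 0" "ball s0 d \<subseteq> S"
    using \<open>open S\<close> s0 openE by blast
  \<comment> \<open>This is \<open>a\<close> along the boundary curve; as \<open>g\<close> has
    derivative 0 at \<open>s0\<close>, only \<open>a \<bullet> u\<close> survives.\<close>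
  have "((\<lambda>s. a \<bullet> Q + s * (a \<bullet> u) + g s * (a \<bullet> v)) has_real_derivative a \<bullet> u) (at s0)"
    using der unfolding s0_def[symmetric] by (auto intro!: derivative_eq_intros)
  moreover have "\<forall>s. \<bar>s0 - s\<bar> < d \<longrightarrow>
      a \<bullet> Q + s0 * (a \<bullet> u) + g s0 * (a \<bullet> v) \<le> a \<bullet> Q + s * (a \<bullet> u) + g s * (a \<bullet> v)"
  proof (intro allI impI)
    fix s assume "\<bar>s0 - s\<bar> < d"
    then have "s \<in> S" using d by (auto simp: dist_real_def)
    then have "Q + s *\<^sub>R u + g s *\<^sub>R v \<in> D"
      using graph sub by blast
    from a[OF this] show
      "a \<bullet> Q + s0 * (a \<bullet> u) + g s0 * (a \<bullet> v) \<le> a \<bullet> Q + s * (a \<bullet> u) + g s * (a \<bullet> v)"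
      by (subst (asm) P) (simp add: inner_add_right)
  qed
  ultimately have au: "a \<bullet> u = 0"
    using DERIV_local_min d(1) by blast
  \<comment> \<open>By the assumption \<open>0\<close>, \<open>P - c\<close> is a multiple of
    \<open>u\<close>, which \<open>a\<close> annihilates.\<close>
  have "a \<bullet> (P - c) = a \<bullet> (((P - c) \<bullet> u) *\<^sub>R u + ((P - c) \<bullet> v) *\<^sub>R v)"
    by (rule arg_cong[OF orthonormal_expansion_2[OF uv]])
  also have "\<dots> = 0"
    using 0 au by simp
  finally show False
    using ac by (simp add: inner_diff_right)
qed

text \<open>Stated for a general curve of directions so that it serves both ends of the chord,
  through \<open>E\<close> and through its negative.\<close>

lemma radial_differentiable:
  fixes D :: "(real^2) set" and E :: "real \<Rightarrow> real^2"
  assumes D: "convex D" "compact D" "c \<in> interior D"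
    and tan: "tangent_line t (frontier D) (c + radial D c (E z) *\<^sub>R E z)"
    and E: "(E has_vector_derivative E') (at z)"
    and unit: "norm (E z) = 1" "norm E' = 1" "E z \<bullet> E' = 0"
  obtains p' where "((\<lambda>y. radial D c (E y)) has_real_derivative p') (at z)"
    and "c + p' *\<^sub>R E' \<in> perpendicular_at t (c + radial D c (E z) *\<^sub>R E z)"
proof -
  define p where "p y = radial D c (E y)" for y
  define P where "P = c + p z *\<^sub>R E z"
  obtain r Q u v S g where "r > 0" and uv: "norm u = 1" "norm v = 1" "u \<bullet> v = 0"
    and t: "t = range (\<lambda>s. Q + s *\<^sub>R u)" and "open S"
    and graph: "frontier D \<inter> ball P r = (\<lambda>s. Q + s *\<^sub>R u + g s *\<^sub>R v) ` S"
    and der: "(g has_real_derivative 0) (at ((P - Q) \<bullet> u))"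
    and Pt: "P \<in> t" "P \<in> frontier D"
    using tan unfolding tangent_line_def P_def p_def by blast
  have uv1: "u \<bullet> u = 1" "v \<bullet> v = 1" "v \<bullet> u = 0"
    using uv by (auto simp: norm_eq_1 inner_commute)
  have Ez: "E z \<noteq> 0" and pz: "p z > 0"
    using unit(1) radial_pos[OF D, of "E z"] by (force simp: p_def)+
  have transv: "E z \<bullet> v \<noteq> 0"
    using tangent_graph_transversal[OF D uv \<open>open S\<close> \<open>r > 0\<close> Pt(2) graph der] pz
    by (simp add: P_def)
  have Econt: "isCont E z"
    using E has_vector_derivative_continuous by blast
  have "isCont (radial D c) (E z)"
    using continuous_on_radial[OF D] Ez
    by (simp add: continuous_on_eq_continuous_at open_Compl)
  then have pcont: "isCont p z"
    unfolding p_def using Econt by (rule isCont_o2[rotated])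
  define X where "X y = c + p y *\<^sub>R E y" for y
  have Xcont: "isCont X z"
    unfolding X_def by (intro continuous_intros pcont Econt)
  have Xz: "X z = P"
    by (simp add: X_def P_def)
  \<comment> \<open>The abscissa of the moving boundary point in the tangent coordinates.\<close>
  define \<sigma> where "\<sigma> y = (X y - Q) \<bullet> u" for y
  have \<sigma>cont: "isCont \<sigma> z"
    unfolding \<sigma>_def by (intro continuous_intros Xcont)
  \<comment> \<open>Caratheodory's form of the derivative avoids dividing by
    \<open>s - \<sigma> z\<close>, which may vanish for boundary points other than \<open>P\<close>
    as far as is known here.\<close>
  obtain h where h: "\<And>s. g s - g (\<sigma> z) = h s * (s - \<sigma> z)" "isCont h (\<sigma> z)" "h (\<sigma> z) = 0"
    using der unfolding CARAT_DERIV \<sigma>_def Xz by blast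
  \<comment> \<open>For \<open>y\<close> near \<open>z\<close> this vector is normal to the secant
    from \<open>P\<close> to \<open>X y\<close>; it tends to the tangent's normal
    \<open>v\<close>.\<close>
  define w where "w y = v - h (\<sigma> y) *\<^sub>R u" for y
  have wcont: "isCont w z"
    unfolding w_def by (intro continuous_intros isCont_o2[OF \<sigma>cont h(2)])
  have wz: "w z = v"
    by (simp add: w_def h(3))
  have "\<forall>\<^sub>F y in at z. X y \<in> ball P r"
    using Xcont \<open>r > 0\<close> by (simp add: isCont_def Xz tendsto_iff dist_commute)
  moreover have "\<forall>\<^sub>F y in at z. E y \<bullet> w y \<noteq> 0"
  proof -
    have "((\<lambda>y. E y \<bullet> w y) \<longlongrightarrow> E z \<bullet> w z) (at z)"
      using Econt wcont unfolding isCont_def by (intro tendsto_intros)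
    then show ?thesis
      using transv by (intro tendsto_imp_eventually_ne) (auto simp: wz)
  qed
  moreover have "\<forall>\<^sub>F y in at z. y \<noteq> z"
    by (rule eventually_neq_at_within)
  \<comment> \<open>Orthogonality of \<open>X y - P\<close> to \<open>w y\<close> is linear in
    \<open>p y - p z\<close> once \<open>X y - P\<close> is split into a change of length and a
    change of direction.\<close>
  ultimately have quot: "\<forall>\<^sub>F y in at z.
      - p z * (((1 / (y - z)) *\<^sub>R (E y - E z)) \<bullet> w y) / (E y \<bullet> w y) = (p y - p z) / (y - z)"
  proof eventually_elim
    case (elim y)
    have "E y \<noteq> 0"
      using elim(2) by auto
    then have "X y \<in> frontier D"
      using radial_frontier[OF D] by (simp add: X_def p_def)
    with elim(1) have "X y \<in> (\<lambda>s. Q + s *\<^sub>R u + g s *\<^sub>R v) ` S"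
      using graph by blast
    then have gy: "(X y - Q) \<bullet> v = g (\<sigma> y)"
      by (auto simp: \<sigma>_def inner_add_left uv1 uv(3))
    have "P \<in> (\<lambda>s. Q + s *\<^sub>R u + g s *\<^sub>R v) ` S"
      using graph Pt(2) \<open>r > 0\<close> by auto
    then have "(P - Q) \<bullet> v = g (\<sigma> z)"
      by (auto simp: \<sigma>_def Xz inner_add_left uv1 uv(3))
    with gy h(1)[of "\<sigma> y"] have "(X y - P) \<bullet> v = h (\<sigma> y) * ((X y - P) \<bullet> u)"
      by (simp add: \<sigma>_def Xz inner_diff_left)
    then have "(X y - P) \<bullet> w y = 0"
      by (simp add: w_def inner_diff_right)
    moreover have "X y - P = (p y - p z) *\<^sub>R E y + p z *\<^sub>R (E y - E z)"
      by (simp add: X_def P_def algebra_simps)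
    ultimately have "(p y - p z) * (E y \<bullet> w y) = - (p z * ((E y - E z) \<bullet> w y))"
      by (simp add: inner_add_left)
    then have "p y - p z = - (p z * ((E y - E z) \<bullet> w y)) / (E y \<bullet> w y)"
      using elim(2) by (simp only: eq_divide_eq) simp
    then show ?case
      by (simp only: inner_scaleR_left) simp
  qed
  \<comment> \<open>The limit of the left side of \<open>quot\<close>; equivalently, the value
    making the velocity \<open>T\<close> below orthogonal to \<open>v\<close>.\<close>
  define p' where "p' = - p z * (E' \<bullet> v) / (E z \<bullet> v)"
  have "((\<lambda>y. norm ((E y - E z) - (y - z) *\<^sub>R E') / norm (y - z)) \<longlongrightarrow> 0) (at z)"
    using E unfolding has_vector_derivative_def has_derivative_iff_norm by simp
  moreover have "\<forall>\<^sub>F y in at z. norm ((E y - E z) - (y - z) *\<^sub>R E') / norm (y - z) =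
      norm ((1 / (y - z)) *\<^sub>R (E y - E z) - E')"
    using eventually_neq_at_within[of z z]
  proof eventually_elim
    case (elim y)
    then have "(1 / (y - z)) *\<^sub>R (E y - E z) - E' =
        (1 / (y - z)) *\<^sub>R ((E y - E z) - (y - z) *\<^sub>R E')"
      by (simp add: scaleR_diff_right)
    then show ?case
      by (simp add: divide_inverse)
  qed
  ultimately have "((\<lambda>y. norm ((1 / (y - z)) *\<^sub>R (E y - E z) - E')) \<longlongrightarrow> 0) (at z)"
    by (rule Lim_transform_eventually)
  then have "((\<lambda>y. (1 / (y - z)) *\<^sub>R (E y - E z)) \<longlongrightarrow> E') (at z)"
    using Lim_null tendsto_norm_zero_iff by blast
  then have "((\<lambda>y. - p z * (((1 / (y - z)) *\<^sub>R (E y - E z)) \<bullet> w y) / (E y \<bullet> w y)) \<longlongrightarrow>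
      - p z * (E' \<bullet> w z) / (E z \<bullet> w z)) (at z)"
    using Econt wcont transv unfolding isCont_def by (intro tendsto_intros) (auto simp: wz)
  then have "((\<lambda>y. (p y - p z) / (y - z)) \<longlongrightarrow> p') (at z)"
    unfolding wz p'_def by (rule Lim_transform_eventually[OF _ quot])
  then have "(p has_real_derivative p') (at z)"
    by (simp add: has_field_derivative_iff)
  moreover have "c + p' *\<^sub>R E' \<in> perpendicular_at t P"
  proof -
    define T where "T = p' *\<^sub>R E z + p z *\<^sub>R E'"
    have Tv: "T \<bullet> v = 0"
      using transv by (simp add: T_def p'_def inner_diff_left)
    then have Tu: "T = (T \<bullet> u) *\<^sub>R u"
      by (metis orthonormal_expansion_2[OF uv, of T] add.right_neutral scale_zero_left)
    have EE: "E z \<bullet> E z = 1" "E' \<bullet> E' = 1" "E' \<bullet> E z = 0"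
      using unit by (auto simp: norm_eq_1 inner_commute)
    have "T \<bullet> E' = p z"
      by (simp add: T_def inner_add_left EE unit(3))
    \<comment> \<open>\<open>T\<close> is a multiple of \<open>u\<close> and is nonzero, since its
      component along \<open>E'\<close> is \<open>p z > 0\<close>.\<close>
    then have "T \<bullet> u \<noteq> 0"
      using Tu pz by (metis inner_zero_left less_irrefl scale_zero_left)
    \<comment> \<open>The left vector is the candidate point minus \<open>P\<close>; it is
      \<open>T\<close> turned by a right angle in the basis \<open>E z\<close>,
      \<open>E'\<close>.\<close>
    have "(p' *\<^sub>R E' - p z *\<^sub>R E z) \<bullet> T = 0"
      by (simp add: T_def inner_add_right inner_diff_left EE unit(3))
    then have "(p' *\<^sub>R E' - p z *\<^sub>R E z) \<bullet> u = 0"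
      using \<open>T \<bullet> u \<noteq> 0\<close> by (subst (asm) Tu) simp
    then show ?thesis
      by (auto simp: perpendicular_at_def t P_def simp flip: scaleR_left_diff_distrib)
  qed
  ultimately show thesis
    unfolding P_def p_def[abs_def] by (rule that)
qed

section \<open>Lines through a point and their rotations\<close>

lemma is_line_through:
  assumes "is_line l" "c \<in> l"
  obtains d where "norm d = 1" "l = range (\<lambda>t. c + t *\<^sub>R d)"
proof -
  obtain b where b: "b \<in> l" "b \<noteq> c"
    using assms aff_dim_sing[of c] unfolding is_line_def
    by (metis is_singletonI' is_singleton_the_elem equals0D singletonD zero_neq_one)
  have "affine hull {c, b} = l"
    using assms b unfolding is_line_def
    by (intro affine_dim_equal) (auto simp: hull_minimal)
  then have l: "l = {x *\<^sub>R c + y *\<^sub>R b |x y. x + y = 1}"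
    by (simp add: affine_hull_2)
  define d where "d = (1 / norm (b - c)) *\<^sub>R (b - c)"
  have "norm d = 1"
    using b by (simp add: d_def)
  moreover have "l = range (\<lambda>t. c + t *\<^sub>R d)"
  proof (intro set_eqI iffI)
    fix p assume "p \<in> l"
    then obtain x y where "p = x *\<^sub>R c + y *\<^sub>R b" "x + y = 1"
      unfolding l by blast
    then have "p = (1 - y) *\<^sub>R c + y *\<^sub>R b"
      by (simp add: eq_diff_eq)
    also have "\<dots> = c + (y * norm (b - c)) *\<^sub>R d"
      using b by (simp add: d_def algebra_simps)
    finally show "p \<in> range (\<lambda>t. c + t *\<^sub>R d)" by blast
  next
    fix p assume "p \<in> range (\<lambda>t. c + t *\<^sub>R d)"
    then obtain t where "p = c + t *\<^sub>R d" by blast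
    then have "p = (1 - t / norm (b - c)) *\<^sub>R c + (t / norm (b - c)) *\<^sub>R b"
      by (simp add: d_def algebra_simps)
    then show "p \<in> l"
      unfolding l by force
  qed
  ultimately show thesis by (rule that)
qed

text \<open>Separates the angle from the vector, so that differentiation only concerns
  \<open>cos\<close> and \<open>sin\<close>.\<close>

lemma rotate_plane_eq:
  "rotate_plane \<phi> x = cos \<phi> *\<^sub>R x + sin \<phi> *\<^sub>R vector [- x $ 2, x $ 1]"
  by (simp add: rotate_plane_def vec_eq_iff forall_2)

lemma rotate_plane_scaleR: "rotate_plane \<phi> (t *\<^sub>R x) = t *\<^sub>R rotate_plane \<phi> x"
  by (simp add: rotate_plane_def vec_eq_iff forall_2 algebra_simps)

lemma norm_rotate_plane [simp]: "norm (rotate_plane \<phi> x) = norm x"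
proof -
  have "rotate_plane \<phi> x \<bullet> rotate_plane \<phi> x = ((cos \<phi>)\<^sup>2 + (sin \<phi>)\<^sup>2) * (x \<bullet> x)"
    unfolding inner_vec_def sum_2 rotate_plane_def vector_2 inner_real_def by algebra
  then show ?thesis
    by (simp add: norm_eq_sqrt_inner)
qed

lemma rotate_plane_has_vector_derivative:
  "((\<lambda>\<phi>. rotate_plane \<phi> x) has_vector_derivative rotate_plane (\<phi> + pi / 2) x) (at \<phi>)"
  unfolding rotate_plane_eq cos_add sin_add
  by (auto intro!: derivative_eq_intros simp: has_vector_derivative_def algebra_simps)

lemma rotate_plane_orthogonal: "rotate_plane \<phi> x \<bullet> rotate_plane (\<phi> + pi / 2) x = 0"
  unfolding inner_vec_def sum_2 rotate_plane_def
  by (simp add: cos_add sin_add algebra_simps)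

lemma rotated_line_range:
  "rotated_line (range (\<lambda>t. c + t *\<^sub>R d)) c \<phi> = range (\<lambda>t. c + t *\<^sub>R rotate_plane \<phi> d)"
  by (simp add: rotated_line_def image_image rotate_plane_scaleR)

section \<open>Extremal chords and concurrent perpendiculars\<close>

theorem corollary11:
  fixes D l0 :: "(real^2) set" and c :: "real^2"
    and A B :: "real \<Rightarrow> real^2" and t1 t2 :: "real \<Rightarrow> (real^2) set" and f :: "real \<Rightarrow> real"
    and \<phi>0 :: real
  assumes "compact D" and "smooth_convex D" and "c \<in> interior D"
    and "is_line l0" and "c \<in> l0"
    and "\<And>\<phi>. closed_segment (A \<phi>) (B \<phi>) = rotated_line l0 c \<phi> \<inter> D"
    and "\<And>\<phi>. f \<phi> = dist (A \<phi>) (B \<phi>)"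
    and "\<And>\<phi>. tangent_line (t1 \<phi>) (frontier D) (A \<phi>)"
    and "\<And>\<phi>. tangent_line (t2 \<phi>) (frontier D) (B \<phi>)"
    and "local_maximizer f \<phi>0 \<or> local_minimizer f \<phi>0"
  shows "CPP (t1 \<phi>0) (t2 \<phi>0) (rotated_line l0 c \<phi>0) (A \<phi>0) (B \<phi>0) c"
proof -
  have D: "convex D" "compact D" "c \<in> interior D"
    using assms(1-3) by (auto simp: smooth_convex_def)
  obtain d where d: "norm d = 1" "l0 = range (\<lambda>t. c + t *\<^sub>R d)"
    using is_line_through[OF assms(4,5)] .
  define E where "E \<phi> = rotate_plane \<phi> d" for \<phi>
  define E' where "E' = rotate_plane (\<phi>0 + pi / 2) d"
  have E: "(E has_vector_derivative E') (at \<phi>0)"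
    unfolding E_def E'_def by (rule rotate_plane_has_vector_derivative)
  have unit: "norm (E \<phi>0) = 1" "norm E' = 1" "E \<phi>0 \<bullet> E' = 0" and E0: "\<And>\<phi>. norm (E \<phi>) = 1"
    by (auto simp: E_def E'_def d(1) rotate_plane_orthogonal)
  have Ene: "E \<phi> \<noteq> 0" for \<phi>
    using E0[of \<phi>] by auto
  have line: "rotated_line l0 c \<phi> = range (\<lambda>t. c + t *\<^sub>R E \<phi>)" for \<phi>
    unfolding d(2) E_def by (rule rotated_line_range)
  define p where "p \<phi> = radial D c (E \<phi>)" for \<phi>
  define q where "q \<phi> = radial D c (- E \<phi>)" for \<phi>
  define X where "X \<phi> = c + p \<phi> *\<^sub>R E \<phi>" for \<phi>
  define Y where "Y \<phi> = c + q \<phi> *\<^sub>R - E \<phi>" for \<phi>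
  \<comment> \<open>A segment determines its endpoints only as an unordered pair, so
    \<open>A\<close> and \<open>B\<close> may be swapped relative to \<open>X\<close> and
    \<open>Y\<close>, differently for each angle.\<close>
  have AB: "{A \<phi>, B \<phi>} = {X \<phi>, Y \<phi>}" for \<phi>
    using assms(6)[of \<phi>] line_inter_eq_closed_segment[OF D Ene[of \<phi>]]
    unfolding line X_def Y_def p_def q_def by (simp only: closed_segment_eq)
  have f: "f = (\<lambda>\<phi>. p \<phi> + q \<phi>)"
  proof
    fix \<phi>
    have "f \<phi> = dist (X \<phi>) (Y \<phi>)"
      using AB[of \<phi>] assms(7)[of \<phi>] by (auto simp: doubleton_eq_iff dist_commute)
    also have "\<dots> = norm ((p \<phi> + q \<phi>) *\<^sub>R E \<phi>)"
      by (simp add: X_def Y_def dist_norm algebra_simps)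
    also have "\<dots> = p \<phi> + q \<phi>"
      using radial_pos[OF D, of "E \<phi>"] radial_pos[OF D, of "- E \<phi>"] Ene[of \<phi>] E0[of \<phi>]
      by (simp add: p_def q_def)
    finally show "f \<phi> = p \<phi> + q \<phi>" .
  qed
  \<comment> \<open>Arbitrary tangents \<open>s\<close> and \<open>t\<close> are allowed so that
    both orders of the endpoints at \<open>\<phi>0\<close> are covered.\<close>
  have perp: "perpendicular_at s (X \<phi>0) \<inter> perpendicular_at t (Y \<phi>0) \<inter>
      perpendicular_at (rotated_line l0 c \<phi>0) c \<noteq> {}"
    if s: "tangent_line s (frontier D) (X \<phi>0)" and t: "tangent_line t (frontier D) (Y \<phi>0)" for s t
  proof -
    obtain p' where p': "(p has_real_derivative p') (at \<phi>0)"
        "c + p' *\<^sub>R E' \<in> perpendicular_at s (X \<phi>0)"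
      using radial_differentiable[where E = E and t = s, OF D s[unfolded X_def p_def] E unit]
      unfolding X_def p_def by blast
    have "((\<lambda>\<phi>. - E \<phi>) has_vector_derivative - E') (at \<phi>0)"
      using E by (rule has_vector_derivative_minus)
    then obtain q' where q': "(q has_real_derivative q') (at \<phi>0)"
        "c + q' *\<^sub>R - E' \<in> perpendicular_at t (Y \<phi>0)"
      using radial_differentiable[where E = "\<lambda>\<phi>. - E \<phi>" and E' = "- E'" and z = \<phi>0 and t = t, OF D] unit t
      unfolding Y_def q_def by auto
    have "(f has_real_derivative p' + q') (at \<phi>0)"
      unfolding f using p'(1) q'(1) by (rule DERIV_add)
    then have "p' + q' = 0"
      using assms(10) unfolding local_maximizer_def local_minimizer_def eventually_nhds_metric
      by (auto simp: dist_real_def abs_minus_commute dest: DERIV_local_max DERIV_local_min)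
    \<comment> \<open>From \<open>q' = - p'\<close>, the point obtained at the end
      \<open>Y \<phi>0\<close> is the one obtained at \<open>X \<phi>0\<close>.\<close>
    then have "c + p' *\<^sub>R E' \<in> perpendicular_at t (Y \<phi>0)"
      using q'(2) by (simp add: eq_neg_iff_add_eq_0[symmetric])
    moreover have "c + p' *\<^sub>R E' \<in> perpendicular_at (rotated_line l0 c \<phi>0) c"
      unfolding line using unit(3)
      by (auto simp: perpendicular_at_def inner_commute simp flip: scaleR_left_diff_distrib)
    ultimately show ?thesis
      using p'(2) by blast
  qed
  show ?thesis
    using AB[of \<phi>0] perp assms(8,9)[of \<phi>0] unfolding CPP_def doubleton_eq_iff
    by (metis Int_commute)
qed

end
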